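(* Let $\mathcal{D}$ be a finite nonempty set of decisions, $\mathcal{X}$ a context set, $z:\mathcal{X}\times\mathcal{D}\to\mathbb{R}^J$ a factor map, and $w^\star,\hat w:\mathcal{X}\to\mathbb{R}^J$. For each $x\in\mathcal{X}$ define $$s^\star_x(d):=w^\star(x)^\top z(x,d),\qquad\hat s_x(d):=\hat w(x)^\top z(x,d),$$ let $d^\star(x)\in\arg\max_{d\in\mathcal{D}}s^\star_x(d)$ and $\hat d(x)\in\arg\max_{d\in\mathcal{D}}\hat s_x(d)$, and define $$\gamma(x):=s^\star_x(d^\star(x))-\max_{d\in\mathcal{D}\setminus\{d^\star(x)\}}s^\star_x(d),$$ with the convention $\gamma(x)=0$ when the maximizer of $s^\star_x$ is not unique, and $$\delta(x):=\max_{d\in\mathcal{D}}\left|(\hat w(x)-w^\star(x))^\top z(x,d)\right|.$$ Let $R(x):=s^\star_x(d^\star(x))-s^\star_x(\hat d(x))$ be the regret. Then for every $x\in\mathcal{X}$, $$R(x)\le2\,\delta(x)\,\mathbf{1}\{\gamma(x)\le2\,\delta(x)\}.$$ In particular, whenever $\gamma(x)>2\,\delta(x)$, one has $\hat d(x)=d^\star(x)$ and $R(x)=0$.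
   Context: If $\mathcal{D}$ has a single element, the maximum over the empty set is taken to be $-\infty$, so $\gamma(x)=+\infty$. *)

theory Defs
  imports "HOL-Analysis.Analysis"
begin

definition score :: "('x \<Rightarrow> real ^ 'j) \<Rightarrow> ('x \<Rightarrow> 'd \<Rightarrow> real ^ 'j) \<Rightarrow> 'x \<Rightarrow> 'd \<Rightarrow> real"
  where "score w z x d = w x \<bullet> z x d"

(* The library's Max is unspecified on the empty set; here the value is -\<infinity>. *)
definition ext_max :: "('d \<Rightarrow> real) \<Rightarrow> 'd set \<Rightarrow> ereal"
  where "ext_max f A = (if A = {} then -\<infinity> else ereal (Max (f ` A)))"

definition unique_maximizer :: "('d \<Rightarrow> real) \<Rightarrow> 'd set \<Rightarrow> bool"
  where "unique_maximizer f D \<longleftrightarrow> (\<exists>!d. is_arg_max f (\<lambda>d. d \<in> D) d)"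

(* Extended-real valued: the margin is \<infinity> when D is a singleton. *)
definition margin ::
  "'d set \<Rightarrow> ('x \<Rightarrow> real ^ 'j) \<Rightarrow> ('x \<Rightarrow> 'd \<Rightarrow> real ^ 'j) \<Rightarrow> ('x \<Rightarrow> 'd) \<Rightarrow> 'x \<Rightarrow> ereal"
  where "margin D w z dstar x =
    (if unique_maximizer (score w z x) D
     then ereal (score w z x (dstar x)) - ext_max (score w z x) (D - {dstar x})
     else 0)"

definition max_score_error ::
  "'d set \<Rightarrow> ('x \<Rightarrow> real ^ 'j) \<Rightarrow> ('x \<Rightarrow> real ^ 'j) \<Rightarrow> ('x \<Rightarrow> 'd \<Rightarrow> real ^ 'j) \<Rightarrow> 'x \<Rightarrow> real"
  where "max_score_error D wstar what z x =
    (MAX d\<in>D. \<bar>(what x - wstar x) \<bullet> z x d\<bar>)"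

definition regret ::
  "('x \<Rightarrow> real ^ 'j) \<Rightarrow> ('x \<Rightarrow> 'd \<Rightarrow> real ^ 'j) \<Rightarrow> ('x \<Rightarrow> 'd) \<Rightarrow> ('x \<Rightarrow> 'd) \<Rightarrow> 'x \<Rightarrow> real"
  where "regret w z dstar dhat x = score w z x (dstar x) - score w z x (dhat x)"

end

theory Submission
  imports Defs
begin

text \<open>Replacing the true weights by the estimated ones changes every score by at most the score
  error, so the estimated maximizer loses at most twice that error. A suboptimal decision loses at
  least the margin, so when the margin exceeds this bound the two maximizers agree.\<close>

text \<open>The inner product is linear in the weights, so the difference of the scores at
  \<open>d\<close> is, up to absolute value, one of the terms of the maximum.\<close>

lemma score_diff_le_max_score_error:
  assumes "finite D" "d \<in> D"
  shows "\<bar>score what z x d - score wstar z x d\<bar> \<le> max_score_error D wstar what z x"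
  unfolding max_score_error_def score_def inner_diff_left[symmetric]
  using assms by (intro Max_ge) auto

text \<open>Passing from \<open>wstar\<close> to \<open>what\<close> costs at most one score error
  at \<open>dstar x\<close> and one at \<open>dhat x\<close>; between these two changes, the
  estimated score favours \<open>dhat x\<close>.\<close>

lemma regret_le_max_score_error:
  assumes "finite D" "dstar x \<in> D"
    and "is_arg_max (score what z x) (\<lambda>d. d \<in> D) (dhat x)"
  shows "regret wstar z dstar dhat x \<le> 2 * max_score_error D wstar what z x"
proof -
  have "dhat x \<in> D" and le: "score what z x (dstar x) \<le> score what z x (dhat x)"
    using assms(2,3) by (auto simp: is_arg_max_linorder)
  with score_diff_le_max_score_error[OF assms(1) assms(2), of what z x wstar]
    score_diff_le_max_score_error[OF assms(1) \<open>dhat x \<in> D\<close>, of what z x wstar]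
  show ?thesis
    unfolding regret_def by linarith
qed

text \<open>With a unique maximizer, \<open>dhat x\<close> is one of the competitors over which the
  margin takes its maximum.\<close>

lemma margin_le_regret:
  assumes "finite D" "is_arg_max (score w z x) (\<lambda>d. d \<in> D) (dstar x)"
    and "dhat x \<in> D" "dhat x \<noteq> dstar x"
  shows "margin D w z dstar x \<le> ereal (regret w z dstar dhat x)"
proof -
  have "score w z x (dhat x) \<le> Max (score w z x ` (D - {dstar x}))"
    using assms by (intro Max_ge) auto
  \<comment> \<open>This settles the case of several maximizers: the margin is then 0 by convention,
    and the regret is nonnegative.\<close>
  moreover have "score w z x (dhat x) \<le> score w z x (dstar x)"
    using assms by (auto simp: is_arg_max_linorder)
  \<comment> \<open>The element \<open>dhat x\<close> excludes the value -\<infinity> of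
    \<open>ext_max\<close>, so the margin is a difference of reals when the maximizer is
    unique.\<close>
  moreover have "D - {dstar x} \<noteq> {}"
    using assms by auto
  ultimately show ?thesis
    by (simp add: margin_def ext_max_def regret_def)
qed

theorem proposition5:
  fixes D :: "'d set" and X :: "'x set"
    and z :: "'x \<Rightarrow> 'd \<Rightarrow> real ^ 'j"
    and wstar what :: "'x \<Rightarrow> real ^ 'j"
    and dstar dhat :: "'x \<Rightarrow> 'd"
  assumes "finite D" and "D \<noteq> {}"
    and "\<And>x. x \<in> X \<Longrightarrow> is_arg_max (score wstar z x) (\<lambda>d. d \<in> D) (dstar x)"
    and "\<And>x. x \<in> X \<Longrightarrow> is_arg_max (score what z x) (\<lambda>d. d \<in> D) (dhat x)"
  shows "\<forall>x\<in>X.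
      regret wstar z dstar dhat x
        \<le> 2 * max_score_error D wstar what z x *
          of_bool (margin D wstar z dstar x \<le> ereal (2 * max_score_error D wstar what z x))
    \<and> (margin D wstar z dstar x > ereal (2 * max_score_error D wstar what z x)
        \<longrightarrow> dhat x = dstar x \<and> regret wstar z dstar dhat x = 0)"
proof
  fix x assume "x \<in> X"
  let ?\<delta> = "max_score_error D wstar what z x"
  have star: "is_arg_max (score wstar z x) (\<lambda>d. d \<in> D) (dstar x)"
    and hat: "is_arg_max (score what z x) (\<lambda>d. d \<in> D) (dhat x)"
    using assms \<open>x \<in> X\<close> by auto
  have in_D: "dstar x \<in> D" "dhat x \<in> D"
    using star hat by (auto simp: is_arg_max_def)
  have bound: "regret wstar z dstar dhat x \<le> 2 * ?\<delta>"
    by (rule regret_le_max_score_error[where D = D]) (use assms(1) in_D hat in auto)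
  have eq: "dhat x = dstar x" if "margin D wstar z dstar x > ereal (2 * ?\<delta>)"
  proof (rule ccontr)
    assume "dhat x \<noteq> dstar x"
    then have "margin D wstar z dstar x \<le> ereal (regret wstar z dstar dhat x)"
      by (intro margin_le_regret assms(1) star in_D)
    also have "\<dots> \<le> ereal (2 * ?\<delta>)"
      using bound by simp
    finally show False
      using that by simp
  qed
  then have "regret wstar z dstar dhat x = 0" if "margin D wstar z dstar x > ereal (2 * ?\<delta>)"
    using that by (simp add: regret_def)
  with bound eq show "regret wstar z dstar dhat x
        \<le> 2 * ?\<delta> * of_bool (margin D wstar z dstar x \<le> ereal (2 * ?\<delta>))
    \<and> (margin D wstar z dstar x > ereal (2 * ?\<delta>)
        \<longrightarrow> dhat x = dstar x \<and> regret wstar z dstar dhat x = 0)"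
    \<comment> \<open>If the indicator is 1, the claim is \<open>bound\<close>; if it is 0, the
      margin is large and the regret vanishes.\<close>
    by (cases "margin D wstar z dstar x \<le> ereal (2 * ?\<delta>)") auto
qed

end
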